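(* Let $a>0$. Then $$\inf_{f\in\mathcal F_0^+([-a,a]),\,f\not\equiv0}U[f]=\inf_{f\in\mathcal P_0^+([-a,a]),\,f\not\equiv0}U[f]=\frac14.$$
   Context: For $K=[-a,a]$, $\mathcal F_{supp}(K)$ is the set of real functions $f=\sum_{i=1}^n P_i\,\mathbf 1_{[a_i,b_i)}$, for some $n\in\mathbb N$, with real polynomials $P_i$ and $-a=a_1<b_1=a_2<\dots<b_{n-1}=a_n<b_n=a$, such that $\lim_{x\to a_i^-}f(x)=f(a_i)$ for $i=2,\dots,n$, and with $f(a)$ equal to the (finite) limit $\lim_{x\to a^-}f(x)$; thus $f$ is a continuous piecewise polynomial on $K$, extended by $0$ outside $K$. $\mathcal F_0^+(K)$ is the set of $f\in\mathcal F_{supp}(K)$ with $f\ge 0$ on $K$ and $f(-a)=f(a)=0$, and $\mathcal P_0^+(K)$ is the set of even $f\in\mathcal F_0^+(K)$. For a nonzero compactly supported $f\in L^2(\mathbb R)$, with $\|\cdot\|$ the $L^2$ norm and $\hat f(\omega)=\int_{\mathbb R}e^{-i\omega x}f(x)\,dx$, set $\alpha[f]=\frac1{\|f\|^2}\int x|f(x)|^2dx$, $\sigma_x^2[f]=\frac1{\|f\|^2}\int (x-\alpha[f])^2|f(x)|^2dx$, $\beta[\hat f]=\frac1{2\pi\|f\|^2}\int_{\mathbb R}\omega|\hat f(\omega)|^2d\omega$, $\sigma_\omega^2[\hat f]=\frac1{2\pi\|f\|^2}\int_{\mathbb R}(\omega-\beta[\hat f])^2|\hat f(\omega)|^2d\omega$,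 and $U[f]=\sigma_x^2[f]\,\sigma_\omega^2[\hat f]$. *)

theory Defs
  imports "HOL-Analysis.Analysis" "HOL-Computational_Algebra.Polynomial"
begin

text \<open>
  The functionals below are meant for nonzero, compactly supported \<open>f\<close> in \<open>L\<^sup>2(\<real>)\<close>.
  The frequency variance of such an \<open>f\<close> may be infinite, so variances take values in
  \<^typ>\<open>ennreal\<close>. The mean \<open>freq_mean f\<close> is a Bochner integral, hence \<open>0\<close> by convention where
  \<open>\<omega> |fourier f \<omega>|\<^sup>2\<close> is not integrable; the frequency variance is then infinite anyway.
\<close>

definition l2_norm_sq :: "(real \<Rightarrow> complex) \<Rightarrow> real" where
  "l2_norm_sq f = (LINT x|lborel. (cmod (f x))\<^sup>2)"

definition fourier :: "(real \<Rightarrow> complex) \<Rightarrow> real \<Rightarrow> complex" where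
  "fourier f \<omega> = (LINT x|lborel. exp (- (\<i> * complex_of_real \<omega> * complex_of_real x)) * f x)"

definition time_mean :: "(real \<Rightarrow> complex) \<Rightarrow> real" where
  "time_mean f = (LINT x|lborel. x * (cmod (f x))\<^sup>2) / l2_norm_sq f"

definition time_variance :: "(real \<Rightarrow> complex) \<Rightarrow> ennreal" where
  "time_variance f =
     (\<integral>\<^sup>+ x. ennreal ((x - time_mean f)\<^sup>2 * (cmod (f x))\<^sup>2) \<partial>lborel) / ennreal (l2_norm_sq f)"

definition freq_mean :: "(real \<Rightarrow> complex) \<Rightarrow> real" where
  "freq_mean f =
     (LINT \<omega>|lborel. \<omega> * (cmod (fourier f \<omega>))\<^sup>2) / (2 * pi * l2_norm_sq f)"

definition freq_variance :: "(real \<Rightarrow> complex) \<Rightarrow> ennreal" where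
  "freq_variance f =
     (\<integral>\<^sup>+ \<omega>. ennreal ((\<omega> - freq_mean f)\<^sup>2 * (cmod (fourier f \<omega>))\<^sup>2) \<partial>lborel)
       / ennreal (2 * pi * l2_norm_sq f)"

definition uncertainty :: "(real \<Rightarrow> complex) \<Rightarrow> ennreal" where
  "uncertainty f = time_variance f * freq_variance f"

text \<open>
  All sets are indexed by the half-length \<open>a\<close> of \<open>K = [-a, a]\<close>. The half-open pieces
  \<open>[l\<^sub>i, r\<^sub>i)\<close> cover \<open>[-a, a)\<close> only; the value at \<open>a\<close> is fixed by the left limit there.
\<close>

definition F_supp :: "real \<Rightarrow> (real \<Rightarrow> real) set" where
  "F_supp a = {f. \<exists>(n::nat) (l::nat \<Rightarrow> real) (r::nat \<Rightarrow> real) (P::nat \<Rightarrow> real poly).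
      n \<ge> 1 \<and> l 1 = - a \<and> r n = a \<and>
      (\<forall>i\<in>{1..n}. l i < r i) \<and> (\<forall>i\<in>{1..<n}. r i = l (i + 1)) \<and>
      (\<forall>x. x \<noteq> a \<longrightarrow> f x = (\<Sum>i=1..n. poly (P i) x * indicator {l i..<r i} x)) \<and>
      (\<forall>i\<in>{2..n}. (f \<longlongrightarrow> f (l i)) (at_left (l i))) \<and>
      (f \<longlongrightarrow> f a) (at_left a)}"

definition F0_plus :: "real \<Rightarrow> (real \<Rightarrow> real) set" where
  "F0_plus a = {f \<in> F_supp a. (\<forall>x\<in>{-a..a}. 0 \<le> f x) \<and> f (- a) = 0 \<and> f a = 0}"

definition P0_plus :: "real \<Rightarrow> (real \<Rightarrow> real) set" where
  "P0_plus a = {f \<in> F0_plus a. \<forall>x. f (- x) = f x}"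

end

theory Submission
  imports Defs "HOL-Probability.Characteristic_Functions" "HOL-Real_Asymp.Real_Asymp"
begin

text \<open>
  A function \<open>f\<close> in \<open>F0_plus a\<close> vanishes at \<open>\<plusminus>a\<close>, so its extension by zero is continuous on the
  line and the piecewise derivative \<open>g\<close> is its weak derivative. Integration by parts gives
  \<open>fourier g \<omega> = \<i> \<omega> fourier f \<omega>\<close>, and for real \<open>f\<close> the frequency mean is zero by symmetry. By
  Plancherel's identity for \<open>g\<close> the uncertainty is therefore the elementary quotient
  \<open>(\<integral> (x - \<alpha>)\<^sup>2 (f x)\<^sup>2) (\<integral> (g x)\<^sup>2) / (\<integral> (f x)\<^sup>2)\<^sup>2\<close>, where \<open>\<alpha>\<close> is the time mean; this is
  \<open>supported_piecewise_C1.uncertainty_eq\<close>.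

  Plancherel's identity is needed only for bounded, integrable, almost everywhere continuous
  functions. It is proved in \<open>plancherel_bounded_AE_continuous\<close> by weighting \<open>|fourier g|\<^sup>2\<close> with a
  Gaussian, applying Fubini's theorem and the known characteristic function of the normal law, and
  letting the Gaussian weight tend to \<open>1\<close>.

  The lower bound \<open>1 / 4\<close> is Heisenberg's inequality: integrating the derivative of
  \<open>(x - \<alpha>) (f x)\<^sup>2\<close> shows that \<open>\<integral> (f x)\<^sup>2 = - 2 \<integral> (x - \<alpha>) f x g x\<close>, and the Cauchy--Schwarz inequality
  applies to the right side.

  The bound is approached by functions of a single polynomial piece: for
  \<open>f x = (a\<^sup>2 - x\<^sup>2) ^ k\<close> on \<open>[-a, a]\<close> with \<open>k \<ge> 1\<close>, which resembles a Gaussian of width of order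
  \<open>a / sqrt k\<close>, all integrals follow from one recursion, and the uncertainty is
  \<open>k (4 k + 1) / ((4 k + 3) (4 k - 2))\<close>. This is independent of \<open>a\<close> and tends to \<open>1 / 4\<close>. These
  functions are even, so the infimum over \<open>P0_plus a\<close> is the same.
\<close>

section \<open>Plancherel's identity for almost everywhere continuous functions\<close>

lemma borel_measurable_cnj [measurable]: "cnj \<in> borel_measurable borel"
  by (intro borel_measurable_continuous_onI continuous_intros)

lemma Fubini_bounded_kernel:
  fixes k :: "real \<Rightarrow> real \<Rightarrow> complex" and g :: "real \<Rightarrow> complex"
  assumes N: "prob_space N" and [measurable_cong, simp]: "sets N = sets borel"
    and g: "integrable lborel g"
    and k[measurable]: "case_prod k \<in> borel_measurable (borel \<Otimes>\<^sub>M borel)"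
    and C: "\<And>t x. cmod (k t x) \<le> C"
  shows "(LINT t|N. LINT x|lborel. k t x * g x) = (LINT x|lborel. (LINT t|N. k t x) * g x)"
proof -
  interpret N: prob_space N by fact
  interpret pair_sigma_finite N lborel
    by (intro pair_sigma_finite.intro N.sigma_finite_measure_axioms lborel.sigma_finite_measure_axioms)
  have [measurable]: "g \<in> borel_measurable borel" using borel_measurable_integrable[OF g] by simp
  have int1: "integrable (N \<Otimes>\<^sub>M lborel) (\<lambda>(t, x). g x)"
    by (rule Fubini_integrable) (use g in auto)
  have "integrable (N \<Otimes>\<^sub>M lborel) (\<lambda>(t, x). k t x * g x)"
  proof (rule Bochner_Integration.integrable_bound)
    show "integrable (N \<Otimes>\<^sub>M lborel) (\<lambda>p. complex_of_real C * (case p of (t, x) \<Rightarrow> g x))"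
      using int1 by (rule integrable_mult_right)
    have "C \<ge> 0" using C[of 0 0] norm_ge_zero order_trans by blast
    then show "AE p in N \<Otimes>\<^sub>M lborel.
        cmod (case p of (t, x) \<Rightarrow> k t x * g x) \<le> cmod (complex_of_real C * (case p of (t, x) \<Rightarrow> g x))"
      using C by (intro AE_I2) (auto simp: norm_mult intro!: mult_right_mono)
  qed measurable
  from Fubini_integral[OF this] show ?thesis
    by simp
qed

lemma cmod_fourier_le:
  assumes "integrable lborel g"
  shows "cmod (fourier g \<omega>) \<le> (LINT x|lborel. cmod (g x))"
proof -
  have "cmod (fourier g \<omega>) \<le>
      (LINT x|lborel. cmod (exp (- (\<i> * complex_of_real \<omega> * complex_of_real x)) * g x))"
    unfolding fourier_def by (rule integral_norm_bound)
  also have "\<dots> = (LINT x|lborel. cmod (g x))"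
    by (simp add: norm_mult)
  finally show ?thesis .
qed

lemma borel_measurable_fourier [measurable]:
  assumes [measurable]: "g \<in> borel_measurable borel"
  shows "fourier g \<in> borel_measurable borel"
  unfolding fourier_def[abs_def] by measurable

text \<open>
  Convolution with the unnormalised Gaussian of width \<open>s\<close> is, up to the factor
  \<open>s * sqrt (2 * pi)\<close>, an average over a standard normal variable.
\<close>

lemma gaussian_kernel_integral:
  fixes h :: "real \<Rightarrow> complex"
  assumes [measurable]: "h \<in> borel_measurable borel" and s: "s > 0"
  shows "(LINT y|lborel. complex_of_real (exp (- ((y - x) / s)\<^sup>2 / 2)) * h y)
     = complex_of_real (s * sqrt (2 * pi)) * (LINT z|std_normal_distribution. h (x + s * z))"
proof -
  have "(LINT y|lborel. complex_of_real (exp (- ((y - x) / s)\<^sup>2 / 2)) * h y)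
     = \<bar>s\<bar> *\<^sub>R (LINT z|lborel. complex_of_real (exp (- z\<^sup>2 / 2)) * h (x + s * z))"
    using s by (subst lborel_integral_real_affine[where c=s and t=x]) auto
  also have "(LINT z|lborel. complex_of_real (exp (- z\<^sup>2 / 2)) * h (x + s * z))
     = (LINT z|lborel. complex_of_real (sqrt (2 * pi)) * (std_normal_density z *\<^sub>R h (x + s * z)))"
    by (intro Bochner_Integration.integral_cong)
      (auto simp: std_normal_density_def scaleR_conv_of_real simp flip: of_real_mult)
  also have "\<dots> = complex_of_real (sqrt (2 * pi)) * (LINT z|std_normal_distribution. h (x + s * z))"
    by (subst integral_density) (auto simp del: mult_scaleR_right)
  finally show ?thesis using s by (simp add: scaleR_conv_of_real)
qed

text \<open>
  Write \<open>|fourier g|\<^sup>2\<close> as a double integral of \<open>g x * cnj (g y)\<close> and integrate the normal variable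
  first: the characteristic function of the normal law turns the oscillating kernel into a
  Gaussian in \<open>(y - x) / s\<close>.
\<close>

lemma fourier_gaussian_mean:
  fixes g :: "real \<Rightarrow> complex"
  assumes g: "integrable lborel g" and s: "s > 0"
  shows "(LINT t|std_normal_distribution. complex_of_real ((cmod (fourier g (t / s)))\<^sup>2))
     = complex_of_real (s * sqrt (2 * pi)) *
       (LINT x|lborel. (LINT z|std_normal_distribution. cnj (g (x + s * z))) * g x)"
proof -
  let ?N = std_normal_distribution
  interpret N: real_distribution ?N by (rule real_dist_normal_dist)
  have N: "prob_space ?N" by (rule N.prob_space_axioms)
  have [measurable]: "g \<in> borel_measurable borel" using borel_measurable_integrable[OF g] by simp
  let ?e = "\<lambda>t x. exp (- (\<i> * complex_of_real (t / s) * complex_of_real x))"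
  have "(LINT t|?N. complex_of_real ((cmod (fourier g (t / s)))\<^sup>2))
      = (LINT t|?N. LINT x|lborel. (cnj (fourier g (t / s)) * ?e t x) * g x)"
  proof (intro Bochner_Integration.integral_cong refl)
    fix t
    have "complex_of_real ((cmod (fourier g (t / s)))\<^sup>2) = cnj (fourier g (t / s)) * fourier g (t / s)"
      by (subst complex_norm_square) (simp add: mult.commute)
    also have "\<dots> = (LINT x|lborel. cnj (fourier g (t / s)) * (?e t x * g x))"
      by (subst (2) fourier_def, subst integral_mult_right_zero) simp
    finally show "complex_of_real ((cmod (fourier g (t / s)))\<^sup>2)
        = (LINT x|lborel. (cnj (fourier g (t / s)) * ?e t x) * g x)"
      by (simp add: mult.assoc)
  qed
  \<comment> \<open>The two factors of \<open>|fourier g|\<^sup>2\<close> are swapped with the normal law one at a time. In this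
    step the conjugate factor belongs to the kernel, and its bound is the \<open>L\<^sup>1\<close> norm of \<open>g\<close>.\<close>
  also have "\<dots> = (LINT x|lborel. (LINT t|?N. cnj (fourier g (t / s)) * ?e t x) * g x)"
  proof (rule Fubini_bounded_kernel[OF N _ g, where C="LINT x|lborel. cmod (g x)"])
    show "(\<lambda>(t, x). cnj (fourier g (t / s)) * ?e t x) \<in> borel_measurable (borel \<Otimes>\<^sub>M borel)"
      by measurable
  qed (use cmod_fourier_le[OF g] in \<open>auto simp: norm_mult\<close>)
  also have "\<dots> = (LINT x|lborel. complex_of_real (s * sqrt (2 * pi)) *
       ((LINT z|?N. cnj (g (x + s * z))) * g x))"
  proof (intro Bochner_Integration.integral_cong refl)
    fix x
    have "(LINT t|?N. cnj (fourier g (t / s)) * ?e t x)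
        = (LINT t|?N. LINT y|lborel. iexp ((y - x) / s * t) * cnj (g y))"
    proof (intro Bochner_Integration.integral_cong refl)
      fix t
      have "cnj (fourier g (t / s)) * ?e t x = (LINT y|lborel. cnj (?e t y * g y)) * ?e t x"
        unfolding fourier_def by (subst Bochner_Integration.integral_cnj) simp
      also have "\<dots> = (LINT y|lborel. cnj (?e t y * g y) * ?e t x)"
        by simp
      also have "\<dots> = (LINT y|lborel. iexp ((y - x) / s * t) * cnj (g y))"
        by (intro Bochner_Integration.integral_cong refl)
          (use s in \<open>simp add: exp_cnj exp_add[symmetric] field_simps\<close>)
      finally show "cnj (fourier g (t / s)) * ?e t x
          = (LINT y|lborel. iexp ((y - x) / s * t) * cnj (g y))" .
    qed
    also have "\<dots> = (LINT y|lborel. (LINT t|?N. iexp ((y - x) / s * t)) * cnj (g y))"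
      by (rule Fubini_bounded_kernel[OF N, where C=1]) (use g in auto)
    also have "\<dots> = (LINT y|lborel. char ?N ((y - x) / s) * cnj (g y))"
      unfolding char_def ..
    also have "\<dots> = complex_of_real (s * sqrt (2 * pi)) * (LINT z|?N. cnj (g (x + s * z)))"
      unfolding char_std_normal_distribution
      by (rule gaussian_kernel_integral) (use s in auto)
    finally show "(LINT t|?N. cnj (fourier g (t / s)) * ?e t x) * g x
       = complex_of_real (s * sqrt (2 * pi)) * ((LINT z|?N. cnj (g (x + s * z))) * g x)"
      by simp
  qed
  finally show ?thesis by simp
qed

lemma fourier_gaussian_weight:
  fixes g :: "real \<Rightarrow> complex"
  assumes g: "integrable lborel g" and s: "s > 0"
  shows "(\<integral>\<^sup>+ \<omega>. ennreal ((cmod (fourier g \<omega>))\<^sup>2 * exp (- (s * \<omega>)\<^sup>2 / 2)) \<partial>lborel)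
     = ennreal (2 * pi * Re (LINT x|lborel.
         (LINT z|std_normal_distribution. cnj (g (x + s * z))) * g x))"
proof -
  let ?N = std_normal_distribution
  interpret N: real_distribution ?N by (rule real_dist_normal_dist)
  let ?J = "LINT x|lborel. (LINT z|?N. cnj (g (x + s * z))) * g x"
  let ?F = "\<lambda>t. (cmod (fourier g (t / s)))\<^sup>2"
  have [measurable]: "g \<in> borel_measurable borel" using borel_measurable_integrable[OF g] by simp
  have intF: "integrable ?N ?F"
    by (rule N.integrable_const_bound[where B="(LINT x|lborel. cmod (g x))\<^sup>2"])
      (auto intro!: power_mono cmod_fourier_le[OF g])
  have "(\<integral>\<^sup>+ \<omega>. ennreal ((cmod (fourier g \<omega>))\<^sup>2 * exp (- (s * \<omega>)\<^sup>2 / 2)) \<partial>lborel)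
      = ennreal (1 / s) * (\<integral>\<^sup>+ t. ennreal (?F t * exp (- t\<^sup>2 / 2)) \<partial>lborel)"
    using s by (subst nn_integral_real_affine[where c="1 / s" and t=0]) auto
  also have "(\<integral>\<^sup>+ t. ennreal (?F t * exp (- t\<^sup>2 / 2)) \<partial>lborel)
      = (\<integral>\<^sup>+ t. ennreal (sqrt (2 * pi)) * (ennreal (std_normal_density t) * ennreal (?F t)) \<partial>lborel)"
    by (intro nn_integral_cong) (auto simp: std_normal_density_def mult_ac simp flip: ennreal_mult)
  also have "\<dots> = ennreal (sqrt (2 * pi)) * (\<integral>\<^sup>+ t. ennreal (?F t) \<partial>?N)"
    by (simp add: nn_integral_cmult nn_integral_density)
  also have "(\<integral>\<^sup>+ t. ennreal (?F t) \<partial>?N) = ennreal (LINT t|?N. ?F t)"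
    by (rule nn_integral_eq_integral[OF intF]) auto
  also have "(LINT t|?N. ?F t) = Re (LINT t|?N. complex_of_real (?F t))"
    by (subst integral_complex_of_real) simp
  also have "\<dots> = s * sqrt (2 * pi) * Re ?J"
    unfolding fourier_gaussian_mean[OF g s] by simp
  finally have eq: "(\<integral>\<^sup>+ \<omega>. ennreal ((cmod (fourier g \<omega>))\<^sup>2 * exp (- (s * \<omega>)\<^sup>2 / 2)) \<partial>lborel)
      = ennreal (1 / s) * (ennreal (sqrt (2 * pi)) * ennreal (s * sqrt (2 * pi) * Re ?J))" .
  have scale: "ennreal (1 / s) * (ennreal (sqrt (2 * pi)) * ennreal r)
      = ennreal (1 / s * (sqrt (2 * pi) * r))" for r
    using s by (subst ennreal_mult', simp, subst ennreal_mult', auto)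
  have "ennreal (1 / s) * (ennreal (sqrt (2 * pi)) * ennreal (s * sqrt (2 * pi) * Re ?J))
      = ennreal (1 / s * (sqrt (2 * pi) * (s * sqrt (2 * pi) * Re ?J)))"
    using scale .
  also have "1 / s * (sqrt (2 * pi) * (s * sqrt (2 * pi) * Re ?J)) = 2 * pi * Re ?J"
    using s by (simp add: algebra_simps)
  finally show ?thesis using eq by simp
qed

text \<open>
  Let \<open>s\<close> decrease to \<open>0\<close> in \<open>fourier_gaussian_weight\<close>. The left side converges by monotone
  convergence, so finiteness of the limit need not be known in advance. On the right, the average
  of \<open>g\<close> near \<open>x\<close> converges to \<open>g x\<close> at each point of continuity, and dominated convergence applies.
\<close>

theorem plancherel_bounded_AE_continuous:
  fixes g :: "real \<Rightarrow> complex"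
  assumes g: "integrable lborel g" and B: "\<And>x. cmod (g x) \<le> B"
    and cont: "AE x in lborel. isCont g x"
  shows "(\<integral>\<^sup>+ \<omega>. ennreal ((cmod (fourier g \<omega>))\<^sup>2) \<partial>lborel) = ennreal (2 * pi * l2_norm_sq g)"
proof -
  let ?N = std_normal_distribution
  interpret N: real_distribution ?N by (rule real_dist_normal_dist)
  have [measurable]: "g \<in> borel_measurable borel" using borel_measurable_integrable[OF g] by simp
  define s :: "nat \<Rightarrow> real" where "s n = inverse (real (Suc n))" for n
  have s_pos: "s n > 0" for n by (simp add: s_def)
  have s0: "s \<longlonglongrightarrow> 0" unfolding s_def by (rule LIMSEQ_inverse_real_of_nat)
  let ?W = "\<lambda>n \<omega>. ennreal ((cmod (fourier g \<omega>))\<^sup>2 * exp (- (s n * \<omega>)\<^sup>2 / 2))"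
  let ?J = "\<lambda>n. LINT x|lborel. (LINT z|?N. cnj (g (x + s n * z))) * g x"
  have "(\<lambda>n. \<integral>\<^sup>+ \<omega>. ?W n \<omega> \<partial>lborel) \<longlonglongrightarrow> (\<integral>\<^sup>+ \<omega>. ennreal ((cmod (fourier g \<omega>))\<^sup>2) \<partial>lborel)"
  proof (rule nn_integral_LIMSEQ)
    show "incseq ?W"
    proof (intro incseq_SucI le_funI ennreal_leI mult_left_mono)
      fix n \<omega>
      have "s (Suc n) \<le> s n" by (simp add: s_def field_simps)
      then have "\<bar>s (Suc n) * \<omega>\<bar> \<le> \<bar>s n * \<omega>\<bar>"
        using s_pos[of n] s_pos[of "Suc n"] by (simp add: abs_mult mult_right_mono)
      then show "exp (- (s n * \<omega>)\<^sup>2 / 2) \<le> exp (- (s (Suc n) * \<omega>)\<^sup>2 / 2)"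
        by (simp only: exp_le_cancel_iff abs_le_square_iff)
    qed auto
    show "(\<lambda>n. ?W n \<omega>) \<longlonglongrightarrow> ennreal ((cmod (fourier g \<omega>))\<^sup>2)" for \<omega>
    proof -
      have "(\<lambda>n. (cmod (fourier g \<omega>))\<^sup>2 * exp (- (s n * \<omega>)\<^sup>2 / 2))
          \<longlonglongrightarrow> (cmod (fourier g \<omega>))\<^sup>2 * exp (- (0 * \<omega>)\<^sup>2 / 2)"
        by (intro tendsto_intros s0) auto
      then show ?thesis by (intro tendsto_ennrealI) simp
    qed
  qed auto
  then have lim1: "(\<lambda>n. ennreal (2 * pi * Re (?J n)))
      \<longlonglongrightarrow> (\<integral>\<^sup>+ \<omega>. ennreal ((cmod (fourier g \<omega>))\<^sup>2) \<partial>lborel)"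
    by (simp only: fourier_gaussian_weight[OF g s_pos])
  have inner: "(\<lambda>n. LINT z|?N. cnj (g (x + s n * z))) \<longlonglongrightarrow> cnj (g x)" if "isCont g x" for x
  proof -
    have "(\<lambda>n. LINT z|?N. cnj (g (x + s n * z))) \<longlonglongrightarrow> (LINT z|?N. cnj (g x))"
    proof (rule integral_dominated_convergence[where w="\<lambda>_. B"])
      show "AE z in ?N. (\<lambda>n. cnj (g (x + s n * z))) \<longlonglongrightarrow> cnj (g x)"
      proof (intro AE_I2 tendsto_cnj isCont_tendsto_compose[OF that])
        fix z
        have "(\<lambda>n. x + s n * z) \<longlonglongrightarrow> x + 0 * z" by (intro tendsto_intros s0)
        then show "(\<lambda>n. x + s n * z) \<longlonglongrightarrow> x" by simp
      qed
    qed (use B in auto)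
    then show ?thesis by (simp add: N.prob_space[simplified])
  qed
  have "?J \<longlonglongrightarrow> (LINT x|lborel. cnj (g x) * g x)"
  proof (rule integral_dominated_convergence[where w="\<lambda>x. B * cmod (g x)"])
    show "integrable lborel (\<lambda>x. B * cmod (g x))" using g by simp
    show "AE x in lborel. (\<lambda>n. (LINT z|?N. cnj (g (x + s n * z))) * g x) \<longlonglongrightarrow> cnj (g x) * g x"
      using cont by eventually_elim (intro tendsto_mult tendsto_const inner)
    show "AE x in lborel. cmod ((LINT z|?N. cnj (g (x + s n * z))) * g x) \<le> B * cmod (g x)" for n
    proof (intro AE_I2)
      fix x
      have "cmod (LINT z|?N. cnj (g (x + s n * z))) \<le> (LINT z|?N. cmod (cnj (g (x + s n * z))))"
        by (rule integral_norm_bound)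
      also have "\<dots> \<le> (LINT z|?N. B)"
        by (rule integral_mono) (use B in \<open>auto intro!: N.integrable_const_bound[where B=B]\<close>)
      finally show "cmod ((LINT z|?N. cnj (g (x + s n * z))) * g x) \<le> B * cmod (g x)"
        using N.prob_space by (simp add: norm_mult mult_right_mono)
    qed
  qed measurable
  also have "(LINT x|lborel. cnj (g x) * g x) = complex_of_real (l2_norm_sq g)"
    unfolding l2_norm_sq_def integral_complex_of_real[symmetric]
    by (intro Bochner_Integration.integral_cong refl) (simp only: complex_norm_square mult.commute)
  finally have "(\<lambda>n. ennreal (2 * pi * Re (?J n))) \<longlonglongrightarrow> ennreal (2 * pi * Re (complex_of_real (l2_norm_sq g)))"
    by (intro tendsto_ennrealI tendsto_mult tendsto_const tendsto_Re)
  with lim1 show ?thesis using LIMSEQ_unique by fastforce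
qed

section \<open>The uncertainty of a continuous, piecewise differentiable function\<close>

lemma integrable_continuous_times_supported:
  fixes k h :: "real \<Rightarrow> 'a::{real_normed_algebra, banach, second_countable_topology}"
  assumes k: "continuous_on UNIV k" and h[measurable]: "h \<in> borel_measurable borel"
    and bd: "bounded (range h)" and out: "\<And>x. x \<notin> {-a..a} \<Longrightarrow> h x = 0"
  shows "integrable lborel (\<lambda>x. k x * h x)"
proof -
  have "bounded (k ` {-a..a})"
    by (intro compact_imp_bounded compact_continuous_image continuous_on_subset[OF k]) auto
  then obtain K where "\<forall>y\<in>k ` {-a..a}. norm y \<le> K"
    unfolding bounded_iff ..
  then have K: "norm (k x) \<le> K" if "x \<in> {-a..a}" for x
    using that by blast
  obtain B where B: "\<And>x. norm (h x) \<le> B"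
    using bd unfolding bounded_iff by blast
  have [measurable]: "k \<in> borel_measurable borel"
    by (rule borel_measurable_continuous_onI[OF k])
  show ?thesis
  proof (rule Bochner_Integration.integrable_bound)
    show "integrable lborel (\<lambda>x. indicator {-a..a} x *\<^sub>R (K * B))"
      by (intro integrable_scaleR_left integrable_real_indicator) (auto simp: emeasure_lborel_Icc_eq)
    show "AE x in lborel. norm (k x * h x) \<le> norm (indicator {-a..a} x *\<^sub>R (K * B))"
    proof (intro AE_I2)
      fix x
      show "norm (k x * h x) \<le> norm (indicator {-a..a} x *\<^sub>R (K * B))"
      proof (cases "x \<in> {-a..a}")
        case True
        have "norm (k x * h x) \<le> norm (k x) * norm (h x)" by (rule norm_mult_ineq)
        also have "\<dots> \<le> K * B"
          using order_trans[OF norm_ge_zero K[OF True]] by (intro mult_mono K[OF True] B) auto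
        finally show ?thesis using True by simp
      qed (use out in auto)
    qed
  qed measurable
qed

lemma integral_derivative_supported_eq_0:
  fixes F G :: "real \<Rightarrow> 'a::euclidean_space"
  assumes "finite S" "0 \<le> a" and cont: "continuous_on {-a..a} F" and ends: "F (-a) = F a"
    and deriv: "\<And>x. x \<in> {-a<..<a} - S \<Longrightarrow> (F has_vector_derivative G x) (at x)"
    and int: "integrable lborel G" and out: "\<And>x. x \<notin> {-a..a} \<Longrightarrow> G x = 0"
  shows "integral\<^sup>L lborel G = 0"
proof -
  have "(G has_integral F a - F (-a)) {-a..a}"
    by (rule fundamental_theorem_of_calculus_interior_strong[OF \<open>finite S\<close> _ deriv cont])
      (use \<open>0 \<le> a\<close> in auto)
  then have 0: "integral {-a..a} G = 0"
    using ends by (simp add: integral_unique)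
  have eq: "(\<lambda>x. indicator {-a..a} x *\<^sub>R G x) = G"
    using out by (auto simp: fun_eq_iff indicator_def)
  have "set_integrable lborel {-a..a} G"
    unfolding set_integrable_def eq by (rule int)
  from set_borel_integral_eq_integral(2)[OF this] show ?thesis
    unfolding set_lebesgue_integral_def eq 0 .
qed

lemma integral_odd_eq_0:
  fixes h :: "real \<Rightarrow> real"
  assumes "\<And>x. h (-x) = - h x"
  shows "integral\<^sup>L lborel h = 0"
  using lborel_integral_real_affine[of "-1" h 0] assms by simp

lemma freq_mean_of_real: "freq_mean (\<lambda>x. complex_of_real (f x)) = 0"
proof -
  have "fourier (\<lambda>x. complex_of_real (f x)) (-\<omega>) = cnj (fourier (\<lambda>x. complex_of_real (f x)) \<omega>)" for \<omega>
    unfolding fourier_def by (subst Bochner_Integration.integral_cnj[symmetric]) (simp add: exp_cnj)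
  then show ?thesis
    unfolding freq_mean_def by (subst integral_odd_eq_0) auto
qed

lemma time_mean_even:
  assumes "\<And>x. f (-x) = f x"
  shows "time_mean f = 0"
  unfolding time_mean_def by (subst integral_odd_eq_0) (auto simp: assms)

lemma l2_norm_sq_of_real: "l2_norm_sq (\<lambda>x. complex_of_real (f x)) = (LINT x|lborel. (f x)\<^sup>2)"
  by (simp add: l2_norm_sq_def)

text \<open>
  A continuous function \<open>f\<close> on the line vanishing outside \<open>[-a, a]\<close>, with a derivative \<open>g\<close> that
  exists, is bounded and is continuous off a finite set \<open>S\<close>. The values of \<open>g\<close> on \<open>S\<close> carry no
  information. Since \<open>f\<close> has no jump at \<open>\<plusminus>a\<close>, \<open>g\<close> is its weak derivative
  on the whole line.
\<close>

locale supported_piecewise_C1 =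
  fixes a :: real and f g :: "real \<Rightarrow> real" and S :: "real set"
  assumes a_pos: "0 < a"
    and f_cont: "continuous_on {-a..a} f"
    and f_ends: "f (-a) = 0" "f a = 0"
    and f_out: "\<And>x. x \<notin> {-a..a} \<Longrightarrow> f x = 0"
    and finite_S: "finite S"
    and f_deriv: "\<And>x. x \<notin> S \<Longrightarrow> (f has_real_derivative g x) (at x)"
    and g_isCont: "\<And>x. x \<notin> S \<Longrightarrow> isCont g x"
    and g_bounded: "bounded (range g)"
    and g_out: "\<And>x. x \<notin> {-a..a} \<Longrightarrow> g x = 0"
begin

lemma f_cont_UNIV: "continuous_on UNIV f"
proof -
  have "continuous_on (- {-a<..<a}) f \<longleftrightarrow> continuous_on (- {-a<..<a}) (\<lambda>_. 0 :: real)"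
  proof (rule continuous_on_cong)
    fix x assume "x \<in> - {-a<..<a}"
    then have "x \<notin> {-a..a} \<or> x = -a \<or> x = a" by auto
    then show "f x = 0" using f_out f_ends by auto
  qed simp
  then have "continuous_on ({-a..a} \<union> - {-a<..<a}) f"
    using f_cont by (intro continuous_on_closed_Un) auto
  also have "{-a..a} \<union> - {-a<..<a} = (UNIV :: real set)" by auto
  finally show ?thesis .
qed

lemma f_bounded: "bounded (range f)"
proof -
  have "range f \<subseteq> f ` {-a..a} \<union> {0}" using f_out by blast
  moreover have "bounded (f ` {-a..a} \<union> {0})"
    using compact_continuous_image[OF f_cont] compact_imp_bounded by auto
  ultimately show ?thesis by (rule bounded_subset[rotated])
qed

lemma f_measurable [measurable]: "f \<in> borel_measurable borel"
  by (rule borel_measurable_continuous_onI[OF f_cont_UNIV])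

lemma g_measurable [measurable]: "g \<in> borel_measurable borel"
  by (rule borel_measurable_continuous_countable_exceptions[OF countable_finite[OF finite_S]])
    (use g_isCont in \<open>auto intro: continuous_at_imp_continuous_on\<close>)

lemma integrable_mult_f:
  "continuous_on UNIV k \<Longrightarrow> integrable lborel (\<lambda>x. k x * f x)"
  by (rule integrable_continuous_times_supported[OF _ _ f_bounded f_out]) auto

lemma integrable_mult_g:
  "continuous_on UNIV k \<Longrightarrow> integrable lborel (\<lambda>x. k x * g x)"
  by (rule integrable_continuous_times_supported[OF _ _ g_bounded g_out]) auto

lemma integrable_mult_f_complex:
  "continuous_on UNIV k \<Longrightarrow> integrable lborel (\<lambda>x. k x * complex_of_real (f x))"
  by (rule integrable_continuous_times_supported[where a=a])
    (use f_bounded f_out in \<open>auto simp: bounded_iff\<close>)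

lemma integrable_mult_g_complex:
  "continuous_on UNIV k \<Longrightarrow> integrable lborel (\<lambda>x. k x * complex_of_real (g x))"
  by (rule integrable_continuous_times_supported[where a=a])
    (use g_bounded g_out in \<open>auto simp: bounded_iff\<close>)

lemma integrable_g2: "integrable lborel (\<lambda>x. (g x)\<^sup>2)"
proof -
  obtain B where "\<And>x. norm (g x) \<le> B"
    using g_bounded unfolding bounded_iff by blast
  then have B: "norm (g x * g x) \<le> B * B" for x
    using norm_ge_zero[of "g x"] by (auto simp only: norm_mult intro!: mult_mono intro: order_trans)
  have "integrable lborel (\<lambda>x. 1 * (g x * g x))"
    by (rule integrable_continuous_times_supported[where a=a])
      (use B g_out in \<open>auto simp: bounded_iff intro!: exI[of _ "B * B"]\<close>)
  then show ?thesis by (simp add: power2_eq_square)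
qed

lemma integrable_mult_f2:
  assumes "continuous_on UNIV k"
  shows "integrable lborel (\<lambda>x. k x * (f x)\<^sup>2)"
  using integrable_mult_f[OF continuous_on_mult[OF assms f_cont_UNIV]]
  by (simp add: power2_eq_square mult.assoc)

lemma fourier_deriv:
  "fourier (\<lambda>x. complex_of_real (g x)) \<omega> = \<i> * \<omega> * fourier (\<lambda>x. complex_of_real (f x)) \<omega>"
proof -
  let ?e = "\<lambda>x. exp (- (\<i> * complex_of_real \<omega> * complex_of_real x))"
  let ?G = "\<lambda>x. ?e x * complex_of_real (g x) + (- (\<i> * \<omega>) * ?e x) * complex_of_real (f x)"
  have e: "continuous_on UNIV ?e" "continuous_on UNIV (\<lambda>x. - (\<i> * \<omega>) * ?e x)"
    by (auto intro!: continuous_intros)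
  note int = integrable_mult_g_complex[OF e(1)] integrable_mult_f_complex[OF e(2)]
  have "integral\<^sup>L lborel ?G = 0"
  proof (rule integral_derivative_supported_eq_0[OF finite_S])
    show "continuous_on {-a..a} (\<lambda>x. ?e x * complex_of_real (f x))"
      using f_cont by (intro continuous_intros)
    show "integrable lborel ?G"
      by (rule Bochner_Integration.integrable_add[OF int])
    fix x assume "x \<in> {-a<..<a} - S"
    then have "(f has_vector_derivative g x) (at x)"
      using f_deriv by (simp add: has_real_derivative_iff_has_vector_derivative)
    then have f': "((\<lambda>x. complex_of_real (f x)) has_vector_derivative complex_of_real (g x)) (at x)"
      by (rule bounded_linear.has_vector_derivative[OF bounded_linear_of_real])
    have e': "(?e has_vector_derivative - (\<i> * \<omega>) * ?e x) (at x)"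
      by (rule has_vector_derivative_real_field) (auto intro!: derivative_eq_intros)
    show "((\<lambda>x. ?e x * complex_of_real (f x)) has_vector_derivative ?G x) (at x)"
      using has_vector_derivative_mult[OF e' f'] by simp
  qed (use a_pos f_ends f_out g_out in auto)
  then have "(LINT x|lborel. ?e x * complex_of_real (g x))
      + (LINT x|lborel. - (\<i> * \<omega>) * ?e x * complex_of_real (f x)) = 0"
    by (simp only: Bochner_Integration.integral_add[OF int])
  moreover have "(LINT x|lborel. - (\<i> * \<omega>) * ?e x * complex_of_real (f x))
      = - (\<i> * \<omega>) * (LINT x|lborel. ?e x * complex_of_real (f x))"
    unfolding mult.assoc[of "- (\<i> * \<omega>)"] by (rule integral_mult_right_zero)
  ultimately show ?thesis
    unfolding fourier_def by (simp add: algebra_simps)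
qed

lemma plancherel_deriv:
  "(\<integral>\<^sup>+ \<omega>. ennreal (\<omega>\<^sup>2 * (cmod (fourier (\<lambda>x. complex_of_real (f x)) \<omega>))\<^sup>2) \<partial>lborel)
     = ennreal (2 * pi * (LINT x|lborel. (g x)\<^sup>2))"
proof -
  have "(\<integral>\<^sup>+ \<omega>. ennreal (\<omega>\<^sup>2 * (cmod (fourier (\<lambda>x. complex_of_real (f x)) \<omega>))\<^sup>2) \<partial>lborel)
      = (\<integral>\<^sup>+ \<omega>. ennreal ((cmod (fourier (\<lambda>x. complex_of_real (g x)) \<omega>))\<^sup>2) \<partial>lborel)"
    by (simp add: fourier_deriv norm_mult power_mult_distrib)
  also have "\<dots> = ennreal (2 * pi * l2_norm_sq (\<lambda>x. complex_of_real (g x)))"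
  proof -
    obtain B where B: "\<And>x. norm (g x) \<le> B"
      using g_bounded unfolding bounded_iff by blast
    have "AE x in lborel. x \<notin> S"
      by (intro AE_not_in finite_imp_null_set_lborel finite_S)
    then have "AE x in lborel. isCont (\<lambda>x. complex_of_real (g x)) x"
      by eventually_elim (use g_isCont in auto)
    then show ?thesis
      by (intro plancherel_bounded_AE_continuous[where B=B])
        (use B integrable_mult_g_complex[of "\<lambda>_. 1"] in auto)
  qed
  finally show ?thesis by (simp add: l2_norm_sq_of_real)
qed

lemma norm_pos:
  assumes "f \<noteq> (\<lambda>x. 0)"
  shows "0 < (LINT x|lborel. (f x)\<^sup>2)"
proof -
  have int: "integrable lborel (\<lambda>x. (f x)\<^sup>2)"
    using integrable_mult_f2[of "\<lambda>_. 1"] by simp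
  have "(LINT x|lborel. (f x)\<^sup>2) \<noteq> 0"
  proof
    assume "(LINT x|lborel. (f x)\<^sup>2) = 0"
    then have "AE x in lborel. f x = 0"
      using integral_nonneg_eq_0_iff_AE[OF int] by simp
    then have "AE x in lborel. x \<notin> {x. f x \<noteq> 0}" by simp
    moreover have op: "open {x. f x \<noteq> 0}"
      by (intro open_Collect_neq f_cont_UNIV continuous_intros)
    ultimately have "{x. f x \<noteq> 0} \<in> null_sets lborel"
      by (subst AE_iff_null_sets) (auto simp: borel_open)
    then have "{x. f x \<noteq> 0} = {}"
      using op open_not_negligible negligible_iff_null_sets null_sets_completionI by blast
    with assms show False by auto
  qed
  moreover have "0 \<le> (LINT x|lborel. (f x)\<^sup>2)" by (rule integral_nonneg_AE) auto
  ultimately show ?thesis by linarith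
qed

lemma uncertainty_eq:
  assumes "f \<noteq> (\<lambda>x. 0)"
  defines "\<alpha> \<equiv> time_mean (\<lambda>x. complex_of_real (f x))"
  shows "uncertainty (\<lambda>x. complex_of_real (f x))
     = ennreal ((LINT x|lborel. (x - \<alpha>)\<^sup>2 * (f x)\<^sup>2) * (LINT x|lborel. (g x)\<^sup>2)
         / (LINT x|lborel. (f x)\<^sup>2)\<^sup>2)"
proof -
  define E T G where "E = (LINT x|lborel. (f x)\<^sup>2)" and "T = (LINT x|lborel. (x - \<alpha>)\<^sup>2 * (f x)\<^sup>2)"
    and "G = (LINT x|lborel. (g x)\<^sup>2)"
  have E: "0 < E" unfolding E_def by (rule norm_pos[OF assms(1)])
  have T: "0 \<le> T" and G: "0 \<le> G" unfolding T_def G_def by (auto intro!: integral_nonneg_AE)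
  have "(\<integral>\<^sup>+ x. ennreal ((x - \<alpha>)\<^sup>2 * (f x)\<^sup>2) \<partial>lborel) = ennreal T"
    unfolding T_def
    by (intro nn_integral_eq_integral integrable_mult_f2 continuous_intros) auto
  then have "time_variance (\<lambda>x. complex_of_real (f x)) = ennreal (T / E)"
    unfolding time_variance_def l2_norm_sq_of_real \<alpha>_def[symmetric] E_def[symmetric]
    using T E by (simp add: divide_ennreal)
  moreover have "freq_variance (\<lambda>x. complex_of_real (f x)) = ennreal (G / E)"
    unfolding freq_variance_def l2_norm_sq_of_real freq_mean_of_real E_def[symmetric]
    using plancherel_deriv G E by (simp add: G_def[symmetric] divide_ennreal)
  ultimately show ?thesis
    unfolding uncertainty_def E_def[symmetric] T_def[symmetric] G_def[symmetric]
    using T G E by (simp add: ennreal_mult[symmetric] power2_eq_square)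
qed

text \<open>The integrand is the derivative of \<open>(x - \<alpha>) * (f x)\<^sup>2\<close>.\<close>

lemma integral_f2_by_parts:
  "(LINT x|lborel. (f x)\<^sup>2) + 2 * (LINT x|lborel. (x - \<alpha>) * f x * g x) = 0"
proof -
  have int: "integrable lborel (\<lambda>x. (f x)\<^sup>2)" "integrable lborel (\<lambda>x. 2 * ((x - \<alpha>) * f x * g x))"
    using integrable_mult_f2[of "\<lambda>_. 1"] f_cont_UNIV
    by (auto intro!: integrable_mult_g continuous_intros)
  have "(LINT x|lborel. (f x)\<^sup>2 + 2 * ((x - \<alpha>) * f x * g x)) = 0"
  proof (rule integral_derivative_supported_eq_0[OF finite_S])
    show "continuous_on {-a..a} (\<lambda>x. (x - \<alpha>) * (f x)\<^sup>2)"
      using f_cont by (intro continuous_intros)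
    show "integrable lborel (\<lambda>x. (f x)\<^sup>2 + 2 * ((x - \<alpha>) * f x * g x))"
      by (rule Bochner_Integration.integrable_add[OF int])
    fix x assume "x \<in> {-a<..<a} - S"
    then have "(f has_real_derivative g x) (at x)" using f_deriv by simp
    then have "((\<lambda>x. (x - \<alpha>) * (f x)\<^sup>2) has_real_derivative (f x)\<^sup>2 + 2 * ((x - \<alpha>) * f x * g x)) (at x)"
      by (auto intro!: derivative_eq_intros simp: algebra_simps)
    then show "((\<lambda>x. (x - \<alpha>) * (f x)\<^sup>2) has_vector_derivative (f x)\<^sup>2 + 2 * ((x - \<alpha>) * f x * g x)) (at x)"
      by (simp add: has_real_derivative_iff_has_vector_derivative)
  qed (use a_pos f_ends f_out g_out in auto)
  then show ?thesis using int by simp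
qed

text \<open>
  Cauchy--Schwarz applied to \<open>(x - \<alpha>) * f x\<close> and \<open>g x\<close>, whose inner product is minus half of the
  squared norm of \<open>f\<close>. The inequality holds for every \<open>\<alpha>\<close>, not only for the mean.
\<close>

lemma heisenberg:
  assumes "f \<noteq> (\<lambda>x. 0)"
  shows "(LINT x|lborel. (f x)\<^sup>2)\<^sup>2
     \<le> 4 * (LINT x|lborel. (x - \<alpha>)\<^sup>2 * (f x)\<^sup>2) * (LINT x|lborel. (g x)\<^sup>2)"
proof -
  define E T G C where "E = (LINT x|lborel. (f x)\<^sup>2)" and "T = (LINT x|lborel. (x - \<alpha>)\<^sup>2 * (f x)\<^sup>2)"
    and "G = (LINT x|lborel. (g x)\<^sup>2)" and "C = (LINT x|lborel. (x - \<alpha>) * f x * g x)"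
  have E: "0 < E" unfolding E_def by (rule norm_pos[OF assms])
  have CE: "C = - E / 2" using integral_f2_by_parts[of \<alpha>] by (simp add: C_def E_def)
  \<comment> \<open>The square of \<open>(x - \<alpha>) * f x + t * g x\<close> has a nonnegative integral for every \<open>t\<close>.\<close>
  have quad: "0 \<le> T - t * E + t\<^sup>2 * G" for t
  proof -
    have int: "integrable lborel (\<lambda>x. (x - \<alpha>)\<^sup>2 * (f x)\<^sup>2)"
      "integrable lborel (\<lambda>x. (x - \<alpha>) * f x * g x)"
      using f_cont_UNIV by (auto intro!: integrable_mult_f2 integrable_mult_g continuous_intros)
    have "0 \<le> (LINT x|lborel. ((x - \<alpha>) * f x + t * g x)\<^sup>2)"
      by (rule integral_nonneg_AE) auto
    also have "\<dots> = (LINT x|lborel. (x - \<alpha>)\<^sup>2 * (f x)\<^sup>2 + 2 * t * ((x - \<alpha>) * f x * g x) + t\<^sup>2 * (g x)\<^sup>2)"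
      by (simp add: power2_eq_square algebra_simps)
    also have "\<dots> = T + 2 * t * C + t\<^sup>2 * G"
      unfolding T_def C_def G_def using int integrable_g2 by simp
    finally show ?thesis by (simp add: CE)
  qed
  have "0 \<le> G" unfolding G_def by (rule integral_nonneg_AE) auto
  \<comment> \<open>If \<open>G\<close> were \<open>0\<close>, the affine function \<open>T - t * E\<close> of \<open>t\<close> would be bounded below.\<close>
  moreover have "G \<noteq> 0"
    using quad[of "(T + 1) / E"] E by auto
  ultimately have G: "0 < G" by simp
  \<comment> \<open>The minimum of the quadratic is at \<open>t = E / (2 * G)\<close>.\<close>
  have "0 \<le> T - E\<^sup>2 / (4 * G)"
    using quad[of "E / (2 * G)"] G by (simp add: power2_eq_square field_simps)
  then have "E\<^sup>2 \<le> 4 * T * G"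
    using G by (simp add: field_simps)
  then show ?thesis unfolding E_def T_def G_def .
qed

theorem uncertainty_ge:
  assumes "f \<noteq> (\<lambda>x. 0)"
  shows "ennreal (1 / 4) \<le> uncertainty (\<lambda>x. complex_of_real (f x))"
  unfolding uncertainty_eq[OF assms]
  using heisenberg[OF assms] norm_pos[OF assms]
  by (intro ennreal_leI) (simp add: field_simps)

end

section \<open>Continuous piecewise polynomials\<close>

lemma tendsto_at_right_indicator_Ico:
  "((indicator {l..<r} :: real \<Rightarrow> real) \<longlongrightarrow> indicator {l..<r} x) (at_right x)"
proof (rule tendsto_eventually)
  consider "x < l" | "l \<le> x" "x < r" | "r \<le> x" by linarith
  then show "eventually (\<lambda>y. (indicator {l..<r} y :: real) = indicator {l..<r} x) (at_right x)"
  proof cases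
    case 1
    show ?thesis using eventually_at_right_real[OF 1] by eventually_elim (use 1 in \<open>auto simp: indicator_def\<close>)
  next
    case 2
    show ?thesis using eventually_at_right_real[OF 2(2)] by eventually_elim (use 2 in \<open>auto simp: indicator_def\<close>)
  next
    case 3
    show ?thesis using eventually_at_right_less[of x] by eventually_elim (use 3 in \<open>auto simp: indicator_def\<close>)
  qed
qed

lemma indicator_Ico_locally_constant:
  fixes x :: real
  assumes "x \<noteq> l" "x \<noteq> r"
  shows "eventually (\<lambda>y. (indicator {l..<r} y :: real) = indicator {l..<r} x) (nhds x)"
proof -
  have "open (if x < l then {..<l} else if x < r then {l<..<r} else {max l r<..})" by simp
  moreover have "x \<in> (if x < l then {..<l} else if x < r then {l<..<r} else {max l r<..})"
    using assms by auto
  ultimately show ?thesis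
    by (rule eventually_nhds_in_open[THEN eventually_mono]) (auto simp: indicator_def split: if_splits)
qed

lemma has_real_derivative_poly_indicator_Ico:
  fixes x :: real
  assumes "x \<noteq> l" "x \<noteq> r"
  shows "((\<lambda>y. poly p y * indicator {l..<r} y) has_real_derivative
     poly (pderiv p) x * indicator {l..<r} x) (at x)"
proof -
  have "((\<lambda>y. poly p y * indicator {l..<r} x) has_real_derivative
     poly (pderiv p) x * indicator {l..<r} x) (at x)"
    by (auto intro!: derivative_eq_intros poly_DERIV)
  moreover have "eventually (\<lambda>y. poly p y * indicator {l..<r} y = poly p y * indicator {l..<r} x) (nhds x)"
    using indicator_Ico_locally_constant[OF assms] by eventually_elim simp
  ultimately show ?thesis
    by (subst DERIV_cong_ev[OF refl _ refl])
qed

lemma isCont_poly_indicator_Ico: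
  fixes x :: real
  assumes "x \<noteq> l" "x \<noteq> r"
  shows "isCont (\<lambda>y. poly p y * indicator {l..<r} y) x"
  using DERIV_isCont[OF has_real_derivative_poly_indicator_Ico[OF assms]] .

text \<open>
  The sum over half-open pieces is automatically right continuous, and the hypotheses on left
  limits give continuity at the inner breakpoints and at \<open>a\<close>. Differentiating piece by piece gives
  the derivative off the breakpoints.
\<close>

lemma piecewise_poly_supported_piecewise_C1:
  fixes a :: real and f :: "real \<Rightarrow> real" and P :: "nat \<Rightarrow> real poly"
  assumes a: "0 < a" and n: "n \<ge> 1" and l1: "l 1 = - a" and rn: "r n = a"
    and lr: "\<And>i. i \<in> {1..n} \<Longrightarrow> l i < r i" and rl: "\<And>i. i \<in> {1..<n} \<Longrightarrow> r i = l (i + 1)"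
    and f: "\<And>x. x \<noteq> a \<Longrightarrow> f x = (\<Sum>i=1..n. poly (P i) x * indicator {l i..<r i} x)"
    and left: "\<And>i. i \<in> {2..n} \<Longrightarrow> (f \<longlongrightarrow> f (l i)) (at_left (l i))"
    and left_a: "(f \<longlongrightarrow> f a) (at_left a)"
    and ends: "f (-a) = 0" "f a = 0"
  shows "supported_piecewise_C1 a f
     (\<lambda>x. \<Sum>i=1..n. poly (pderiv (P i)) x * indicator {l i..<r i} x) (l ` {1..n} \<union> r ` {1..n})"
proof -
  let ?S = "l ` {1..n} \<union> r ` {1..n}"
  let ?h = "\<lambda>x. \<Sum>i=1..n. poly (P i) x * indicator {l i..<r i} x"
  let ?g = "\<lambda>x. \<Sum>i=1..n. poly (pderiv (P i)) x * indicator {l i..<r i} x"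
  have l_ge: "i \<le> n \<Longrightarrow> - a \<le> l i" if "1 \<le> i" for i
    using that
  proof (induction i rule: dec_induct)
    case (step i)
    then show ?case using lr[of i] rl[of i] by auto
  qed (use l1 in simp)
  have r_le: "1 \<le> i \<Longrightarrow> r i \<le> a" if "i \<le> n" for i
    using that
  proof (induction i rule: inc_induct)
    case (step i)
    then show ?case using lr[of "i + 1"] rl[of i] by auto
  qed (use rn in simp)
  have outside: "indicator {l i..<r i} x = (0 :: real)" if "i \<in> {1..n}" "x \<notin> {-a..<a}" for i x
    using l_ge[of i] r_le[of i] that by (auto simp: indicator_def)
  have a_S: "a \<in> ?S" using n rn by auto
  have f_ev: "eventually (\<lambda>y. f y = ?h y) (nhds x)" if "x \<noteq> a" for x
  proof -
    have "eventually (\<lambda>y. y \<in> - {a}) (nhds x)"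
      by (rule eventually_nhds_in_open) (use that in auto)
    then show ?thesis by eventually_elim (use f in auto)
  qed
  have deriv: "(f has_real_derivative ?g x) (at x)" if x: "x \<notin> ?S" for x
  proof -
    have "(?h has_real_derivative ?g x) (at x)"
      by (intro DERIV_sum has_real_derivative_poly_indicator_Ico) (use x in auto)
    moreover have "eventually (\<lambda>y. f y = ?h y) (nhds x)"
      by (rule f_ev) (use x a_S in auto)
    ultimately show ?thesis
      by (subst DERIV_cong_ev[OF refl _ refl])
  qed
  have right: "(f \<longlongrightarrow> f x) (at_right x)" if "x \<noteq> a" for x
  proof -
    have "(?h \<longlongrightarrow> ?h x) (at_right x)"
      by (intro tendsto_intros tendsto_at_right_indicator_Ico)
    moreover have "eventually (\<lambda>y. ?h y = f y) (at_right x)"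
      using filter_leD[OF at_within_le_nhds f_ev[OF that]] by eventually_elim simp
    ultimately show ?thesis
      unfolding f[OF that] by (rule Lim_transform_eventually)
  qed
  \<comment> \<open>A breakpoint other than \<open>-a\<close> is either \<open>a\<close> or some \<open>l i\<close> with \<open>i \<ge> 2\<close>, as \<open>r i = l (i + 1)\<close>.\<close>
  have left': "(f \<longlongrightarrow> f x) (at_left x)" if x: "x \<noteq> -a" for x
  proof (cases "x \<in> ?S")
    case False
    then have "isCont f x" using deriv DERIV_isCont by blast
    then show ?thesis
      unfolding isCont_def by (rule tendsto_within_subset) auto
  next
    case True
    then have "x = a \<or> (\<exists>i\<in>{2..n}. x = l i)"
    proof
      assume "x \<in> l ` {1..n}"
      then obtain i where i: "i \<in> {1..n}" "x = l i" by auto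
      with x l1 have "i \<noteq> 1" by auto
      with i show ?thesis by (intro disjI2 bexI[of _ i]) auto
    next
      assume "x \<in> r ` {1..n}"
      then obtain i where i: "i \<in> {1..n}" "x = r i" by auto
      show ?thesis
      proof (cases "i = n")
        case False
        with i rl[of i] show ?thesis by (intro disjI2 bexI[of _ "i + 1"]) auto
      qed (use i rn in simp)
    qed
    then show ?thesis using left left_a by auto
  qed
  show ?thesis
  proof
    show "continuous_on {-a..a} f"
      unfolding continuous_on_def
    proof
      fix x assume x: "x \<in> {-a..a}"
      show "(f \<longlongrightarrow> f x) (at x within {-a..a})"
      proof (cases "x = -a \<or> x = a")
        case True
        then show ?thesis
        proof
          assume "x = -a"
          then show ?thesis using right[of x] a by (simp add: at_within_Icc_at_right)
        next
          assume "x = a"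
          then show ?thesis using left'[of x] a by (simp add: at_within_Icc_at_left)
        qed
      next
        case False
        with x show ?thesis
          using right[of x] left'[of x] by (simp add: at_within_Icc_at filterlim_split_at)
      qed
    qed
    show "f x = 0" if "x \<notin> {-a..a}" for x
    proof -
      have "x \<noteq> a" "x \<notin> {-a..<a}" using that a by auto
      then show ?thesis using outside by (subst f) (auto intro!: sum.neutral)
    qed
    show "isCont ?g x" if "x \<notin> ?S" for x
      by (intro isCont_sum ballI isCont_poly_indicator_Ico) (use that in auto)
    show "?g x = 0" if "x \<notin> {-a..a}" for x
    proof -
      have "x \<notin> {-a..<a}" using that by auto
      then show ?thesis using outside by (simp add: sum.neutral)
    qed
    show "bounded (range ?g)"
    proof -
      let ?D = "\<lambda>x. \<Sum>i=1..n. \<bar>poly (pderiv (P i)) x\<bar>"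
      have "compact (?D ` {-a..a})"
        by (intro compact_continuous_image continuous_intros) auto
      then have "bounded (?D ` {-a..a})" by (rule compact_imp_bounded)
      then obtain K where K: "\<forall>y\<in>?D ` {-a..a}. norm y \<le> K"
        unfolding bounded_iff ..
      have "range ?g \<subseteq> cball 0 \<bar>K\<bar>"
      proof (safe, simp only: mem_cball_0)
        fix x
        show "norm (?g x) \<le> \<bar>K\<bar>"
        proof (cases "x \<in> {-a..a}")
          case True
          have "norm (?g x) \<le> ?D x"
            by (intro sum_norm_le) (auto simp: indicator_def)
          also have "\<dots> \<le> norm (?D x)" by simp
          also have "\<dots> \<le> K" using K True by blast
          finally show ?thesis by simp
        next
          case False
          then have "x \<notin> {-a..<a}" by auto
          then have "?g x = 0" using outside by (simp add: sum.neutral)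
          then show ?thesis by simp
        qed
      qed
      then show ?thesis by (rule bounded_subset[OF bounded_cball])
    qed
  qed (use a ends deriv in auto)
qed

lemma F0_plus_supported_piecewise_C1:
  assumes "0 < a" "f \<in> F0_plus a"
  obtains g S where "supported_piecewise_C1 a f g S"
proof -
  from assms(2) obtain n l r P where
    "n \<ge> (1::nat)" "l 1 = - a" "r n = a"
    "\<forall>i\<in>{1..n}. l i < r i" "\<forall>i\<in>{1..<n}. r i = l (i + 1)"
    "\<forall>x. x \<noteq> a \<longrightarrow> f x = (\<Sum>i=1..n. poly (P i) x * indicator {l i..<r i} x)"
    "\<forall>i\<in>{2..n}. (f \<longlongrightarrow> f (l i)) (at_left (l i))" "(f \<longlongrightarrow> f a) (at_left a)"
    "f (-a) = 0" "f a = 0"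
    unfolding F0_plus_def F_supp_def by blast
  then show ?thesis
    using piecewise_poly_supported_piecewise_C1[OF assms(1), of n l r f P] that by blast
qed

section \<open>A minimising sequence\<close>

text \<open>
  The function \<open>(a\<^sup>2 - x\<^sup>2) ^ k\<close> cut off to \<open>[-a, a]\<close>. The half-open indicator matches the form of the
  polynomial pieces; for \<open>k \<ge> 1\<close> the value at \<open>a\<close> is \<open>0\<close> in any case, while for \<open>k = 0\<close> (which
  occurs in the derivative of the case \<open>k = 1\<close>) a single point does not affect the integrals.
\<close>

definition parabola_power :: "real \<Rightarrow> nat \<Rightarrow> real \<Rightarrow> real" where
  "parabola_power a k x = (a\<^sup>2 - x\<^sup>2) ^ k * indicator {-a..<a} x"

lemma parabola_power_even:
  assumes "1 \<le> k"
  shows "parabola_power a k (-x) = parabola_power a k x"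
  using assms by (cases "\<bar>x\<bar> = a") (auto simp: parabola_power_def indicator_def power_0_left split: abs_split)

lemma parabola_power_nonneg: "0 \<le> parabola_power a k x"
proof (cases "x \<in> {-a..<a}")
  case True
  then have "x\<^sup>2 \<le> a\<^sup>2" by (intro abs_le_square_iff[THEN iffD1]) auto
  then show ?thesis by (simp add: parabola_power_def)
qed (simp add: parabola_power_def)

lemma parabola_power_poly:
  "parabola_power a k x = (\<Sum>i=1..1::nat. poly ([:a\<^sup>2, 0, -1:] ^ k) x * indicator {-a..<a} x)"
  by (simp add: parabola_power_def power2_eq_square)

lemma parabola_power_left_limit:
  assumes "0 < a" "1 \<le> k"
  shows "(parabola_power a k \<longlongrightarrow> parabola_power a k a) (at_left a)"
proof -
  have "((\<lambda>x. (a\<^sup>2 - x\<^sup>2) ^ k) \<longlongrightarrow> (a\<^sup>2 - a\<^sup>2) ^ k) (at_left a)"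
    by (intro tendsto_intros)
  moreover have "eventually (\<lambda>x. (a\<^sup>2 - x\<^sup>2) ^ k = parabola_power a k x) (at_left a)"
    using eventually_at_left_real[of "-a" a] assms(1)
    by (auto simp: parabola_power_def elim!: eventually_mono)
  ultimately have "(parabola_power a k \<longlongrightarrow> (a\<^sup>2 - a\<^sup>2) ^ k) (at_left a)"
    by (rule Lim_transform_eventually)
  then show ?thesis
    using assms(2) by (simp add: parabola_power_def power_0_left)
qed

lemma parabola_power_in_P0_plus:
  assumes "0 < a" "1 \<le> k"
  shows "parabola_power a k \<in> P0_plus a"
proof -
  have "parabola_power a k \<in> F_supp a"
    unfolding F_supp_def
    using assms parabola_power_left_limit[OF assms] parabola_power_poly[of a k]
    by (intro CollectI exI[of _ 1] exI[of _ "\<lambda>_. -a"] exI[of _ "\<lambda>_. a"]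
        exI[of _ "\<lambda>_. [:a\<^sup>2, 0, -1:] ^ k"]) auto
  then show ?thesis
    unfolding P0_plus_def F0_plus_def
    using assms parabola_power_nonneg parabola_power_even
    by (auto simp: parabola_power_def power_0_left)
qed

lemma parabola_power_nonzero:
  assumes "0 < a"
  shows "parabola_power a k \<noteq> (\<lambda>x. 0)"
proof
  assume "parabola_power a k = (\<lambda>x. 0)"
  then have "parabola_power a k 0 = 0" by simp
  with assms show False by (simp add: parabola_power_def)
qed

lemma parabola_power_supported_piecewise_C1:
  assumes "0 < a" "1 \<le> k"
  shows "supported_piecewise_C1 a (parabola_power a k)
     (\<lambda>x. - 2 * real k * x * parabola_power a (k - 1) x) {-a, a}"
proof -
  have "supported_piecewise_C1 a (parabola_power a k)
     (\<lambda>x. \<Sum>i=1..1::nat. poly (pderiv ([:a\<^sup>2, 0, -1:] ^ k)) x * indicator {-a..<a} x)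
     ((\<lambda>_. -a) ` {1..1::nat} \<union> (\<lambda>_. a) ` {1..1::nat})"
    by (rule piecewise_poly_supported_piecewise_C1[where l="\<lambda>_. -a" and r="\<lambda>_. a" and P="\<lambda>_. [:a\<^sup>2, 0, -1:] ^ k"])
      (use assms parabola_power_left_limit[OF assms] parabola_power_poly[of a k] in
        \<open>auto simp: parabola_power_def power_0_left\<close>)
  also have "(\<lambda>x. \<Sum>i=1..1::nat. poly (pderiv ([:a\<^sup>2, 0, -1:] ^ k)) x * indicator {-a..<a} x)
     = (\<lambda>x. - 2 * real k * x * parabola_power a (k - 1) x)"
    using assms by (auto simp: fun_eq_iff pderiv_power pderiv_pCons parabola_power_def power2_eq_square algebra_simps)
  finally show ?thesis by (simp add: insert_commute)
qed

lemma integrable_parabola_power: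
  assumes "continuous_on UNIV p"
  shows "integrable lborel (\<lambda>x. p x * parabola_power a k x)"
proof -
  have "integrable lborel (\<lambda>x. (p x * (a\<^sup>2 - x\<^sup>2) ^ k) * indicator {-a..<a} x)"
    by (rule integrable_continuous_times_supported[where a=a])
      (use assms in \<open>auto intro!: continuous_intros simp: bounded_iff indicator_def\<close>)
  then show ?thesis by (simp add: parabola_power_def mult.assoc)
qed

lemma parabola_power_Suc: "parabola_power a (Suc k) x = (a\<^sup>2 - x\<^sup>2) * parabola_power a k x"
  by (simp add: parabola_power_def)

lemma parabola_power_square: "(parabola_power a k x)\<^sup>2 = parabola_power a (2 * k) x"
  by (simp add: parabola_power_def power_mult_distrib power_mult[symmetric] mult.commute[of k] indicator_def)

text \<open>The recursion integrates the derivative of \<open>x * (a\<^sup>2 - x\<^sup>2) ^ (m + 1)\<close>.\<close>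

lemma integral_parabola_power_Suc:
  assumes "0 < a"
  shows "(2 * real m + 3) * (LINT x|lborel. parabola_power a (Suc m) x)
     = (2 * real m + 2) * a\<^sup>2 * (LINT x|lborel. parabola_power a m x)"
proof -
  let ?G = "\<lambda>x. (2 * real m + 3) * parabola_power a (Suc m) x - (2 * real m + 2) * a\<^sup>2 * parabola_power a m x"
  note int = integrable_parabola_power[of "\<lambda>_. 2 * real m + 3" a "Suc m", OF continuous_on_const]
    integrable_parabola_power[of "\<lambda>_. (2 * real m + 2) * a\<^sup>2" a m, OF continuous_on_const]
  have "integral\<^sup>L lborel ?G = 0"
  proof (rule integral_derivative_supported_eq_0[where S="{}"])
    show "continuous_on {-a..a} (\<lambda>x. x * (a\<^sup>2 - x\<^sup>2) ^ Suc m)"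
      by (intro continuous_intros)
    show "integrable lborel ?G"
      by (rule Bochner_Integration.integrable_diff[OF int])
    fix x assume "x \<in> {-a<..<a} - {}"
    then have G: "?G x = (2 * real m + 3) * (a\<^sup>2 - x\<^sup>2) ^ Suc m - (2 * real m + 2) * a\<^sup>2 * (a\<^sup>2 - x\<^sup>2) ^ m"
      by (simp add: parabola_power_def)
    have "((\<lambda>x. x * (a\<^sup>2 - x\<^sup>2) ^ Suc m) has_real_derivative
        (a\<^sup>2 - x\<^sup>2) ^ Suc m + x * (real (Suc m) * (- 2 * x) * (a\<^sup>2 - x\<^sup>2) ^ m)) (at x)"
      by (rule derivative_eq_intros refl | simp)+
    also have "(a\<^sup>2 - x\<^sup>2) ^ Suc m + x * (real (Suc m) * (- 2 * x) * (a\<^sup>2 - x\<^sup>2) ^ m) = ?G x"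
      unfolding G by (simp add: algebra_simps power2_eq_square)
    finally show "((\<lambda>x. x * (a\<^sup>2 - x\<^sup>2) ^ Suc m) has_vector_derivative ?G x) (at x)"
      by (simp only: has_real_derivative_iff_has_vector_derivative)
  qed (use assms in \<open>auto simp: parabola_power_def\<close>)
  then show ?thesis
    unfolding Bochner_Integration.integral_diff[OF int] by simp
qed

text \<open>
  Since \<open>x\<^sup>2 = a\<^sup>2 - (a\<^sup>2 - x\<^sup>2)\<close>, both second moments are combinations of the integrals \<open>J m\<close> of
  \<open>parabola_power a m\<close>, and the recursion reduces all of them to \<open>J (2 * j)\<close>, which cancels.
\<close>

lemma uncertainty_parabola_power:
  assumes "0 < a"
  shows "uncertainty (\<lambda>x. complex_of_real (parabola_power a (Suc j) x))
     = ennreal ((real j + 1) * (4 * real j + 5) / ((4 * real j + 7) * (4 * real j + 2)))"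
proof -
  let ?f = "parabola_power a (Suc j)"
  interpret supported_piecewise_C1 a ?f "\<lambda>x. - 2 * real (Suc j) * x * parabola_power a j x" "{-a, a}"
    using parabola_power_supported_piecewise_C1[OF assms, of "Suc j"] by simp
  define J where "J m = (LINT x|lborel. parabola_power a m x)" for m
  have int: "integrable lborel (\<lambda>x. c * parabola_power a m x)" for c m
    using integrable_parabola_power[of "\<lambda>_. c"] by simp
  have rec: "J (Suc m) = (2 * real m + 2) * a\<^sup>2 * J m / (2 * real m + 3)" for m
    using integral_parabola_power_Suc[OF assms, of m] by (simp add: J_def field_simps)
  have E: "(LINT x|lborel. (?f x)\<^sup>2) = J (2 * j + 2)"
    by (simp add: J_def parabola_power_square)
  have moment: "(LINT x|lborel. c * (x\<^sup>2 * parabola_power a m x)) = c * a\<^sup>2 * J m / (2 * real m + 3)" for c m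
  proof -
    have "(LINT x|lborel. c * (x\<^sup>2 * parabola_power a m x))
        = (LINT x|lborel. (c * a\<^sup>2) * parabola_power a m x - c * parabola_power a (Suc m) x)"
      by (intro Bochner_Integration.integral_cong) (auto simp: parabola_power_Suc algebra_simps)
    also have "\<dots> = c * a\<^sup>2 * J m - c * J (Suc m)"
      using Bochner_Integration.integral_diff[OF int int] by (simp add: J_def)
    also have "\<dots> = c * a\<^sup>2 * J m / (2 * real m + 3)"
      unfolding rec by (simp add: field_simps)
    finally show ?thesis .
  qed
  have T: "(LINT x|lborel. (x - 0)\<^sup>2 * (?f x)\<^sup>2) = a\<^sup>2 * J (2 * j + 2) / (4 * real j + 7)"
    using moment[of 1 "2 * j + 2"] by (simp add: parabola_power_square)
  have G: "(LINT x|lborel. (- 2 * real (Suc j) * x * parabola_power a j x)\<^sup>2)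
      = 4 * (real j + 1)\<^sup>2 * a\<^sup>2 * J (2 * j) / (4 * real j + 3)"
  proof -
    have "(LINT x|lborel. (- 2 * real (Suc j) * x * parabola_power a j x)\<^sup>2)
        = (LINT x|lborel. (4 * (real j + 1)\<^sup>2) * (x\<^sup>2 * parabola_power a (2 * j) x))"
      by (intro Bochner_Integration.integral_cong)
        (simp_all only: parabola_power_square[symmetric] power2_eq_square of_nat_Suc, simp_all add: algebra_simps)
    then show ?thesis using moment[of "4 * (real j + 1)\<^sup>2" "2 * j"] by simp
  qed
  have J2: "J (2 * j + 2) = (4 * real j + 4) * (4 * real j + 2) * a ^ 4 * J (2 * j)
      / ((4 * real j + 5) * (4 * real j + 3))"
  proof -
    have "J (Suc (2 * j)) = (4 * real j + 2) * a\<^sup>2 * J (2 * j) / (4 * real j + 3)"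
      using rec[of "2 * j"] by simp
    moreover have "J (2 * j + 2) = (4 * real j + 4) * a\<^sup>2 * J (Suc (2 * j)) / (4 * real j + 5)"
      using rec[of "Suc (2 * j)"] by (simp add: algebra_simps)
    ultimately show ?thesis by (simp add: power4_eq_xxxx power2_eq_square mult_ac)
  qed
  have "0 < J (2 * j + 2)"
    using norm_pos[OF parabola_power_nonzero[OF assms]] by (simp only: E)
  then have J0: "J (2 * j) \<noteq> 0" unfolding J2 by auto
  have mean: "time_mean (\<lambda>x. complex_of_real (?f x)) = 0"
    by (rule time_mean_even) (simp add: parabola_power_even)
  have "(a\<^sup>2 * J (2 * j + 2) / (4 * real j + 7)) * (4 * (real j + 1)\<^sup>2 * a\<^sup>2 * J (2 * j) / (4 * real j + 3))
      / (J (2 * j + 2))\<^sup>2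
      = (real j + 1) * (4 * real j + 5) / ((4 * real j + 7) * (4 * real j + 2))"
  proof -
    have nz: "4 * real j + 2 \<noteq> 0" "4 * real j + 3 \<noteq> 0" "4 * real j + 5 \<noteq> 0" "4 * real j + 7 \<noteq> 0"
      "real j + 1 \<noteq> 0" by linarith+
    have eq: "4 * real j + 4 = 4 * (real j + 1)" by simp
    show ?thesis
      unfolding J2 eq using nz J0 assms
      by (simp add: divide_simps del: distrib_left_numeral distrib_right_numeral) algebra
  qed
  then show ?thesis
    unfolding uncertainty_eq[OF parabola_power_nonzero[OF assms]] mean T G E by (rule arg_cong)
qed

lemma uncertainty_parabola_power_tendsto:
  assumes "0 < a"
  shows "(\<lambda>j. uncertainty (\<lambda>x. complex_of_real (parabola_power a (Suc j) x))) \<longlonglongrightarrow> ennreal (1 / 4)"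
  unfolding uncertainty_parabola_power[OF assms]
  by (intro tendsto_ennrealI) real_asymp

section \<open>The infimum of the uncertainty\<close>

theorem corollary3p4:
  fixes a :: real
  assumes "a > 0"
  shows "(INF f\<in>{f \<in> F0_plus a. f \<noteq> (\<lambda>x. 0)}. uncertainty (\<lambda>x. complex_of_real (f x)))
           = (INF f\<in>{f \<in> P0_plus a. f \<noteq> (\<lambda>x. 0)}. uncertainty (\<lambda>x. complex_of_real (f x)))
       \<and> (INF f\<in>{f \<in> P0_plus a. f \<noteq> (\<lambda>x. 0)}. uncertainty (\<lambda>x. complex_of_real (f x))) = ennreal (1/4)"
proof -
  let ?U = "\<lambda>f. uncertainty (\<lambda>x. complex_of_real (f x))"
  let ?F = "{f \<in> F0_plus a. f \<noteq> (\<lambda>x. 0)}" and ?P = "{f \<in> P0_plus a. f \<noteq> (\<lambda>x. 0)}"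
  have "ennreal (1/4) \<le> (INF f\<in>?F. ?U f)"
  proof (rule INF_greatest)
    fix f assume f: "f \<in> ?F"
    then obtain g S where "supported_piecewise_C1 a f g S"
      using F0_plus_supported_piecewise_C1[OF assms] by blast
    then show "ennreal (1/4) \<le> ?U f"
      by (rule supported_piecewise_C1.uncertainty_ge) (use f in simp)
  qed
  moreover have "(INF f\<in>?F. ?U f) \<le> (INF f\<in>?P. ?U f)"
    by (rule INF_superset_mono) (auto simp: P0_plus_def)
  moreover have "(INF f\<in>?P. ?U f) \<le> ennreal (1/4)"
  proof (rule LIMSEQ_le_const[OF uncertainty_parabola_power_tendsto[OF assms]])
    show "\<exists>N. \<forall>n\<ge>N. (INF f\<in>?P. ?U f) \<le> ?U (parabola_power a (Suc n))"
      using parabola_power_in_P0_plus[OF assms] parabola_power_nonzero[OF assms]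
      by (intro exI allI impI INF_lower) auto
  qed
  ultimately show ?thesis by (auto intro: antisym)
qed

end
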